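(* Let $k\ge 1$ be an integer, let $U_n:=K_3\times P_n$ for $n\ge 1$, and let $T(x,y):=\sum_{n\geq 1}x^{n}\sum_{T\in\mathcal{T}^{(k)}(U_n)} y^{\rho(T)}$. Then $T(x,y)=p(x,y)/q(x,y)$, where \begin{multline*} p(x,y)= k x y \Bigl(1 - (1 - k) y (3 - (2 - k) y) - x (1 - y) \bigl(4 - y (13 - 5 k) + (3 + k) (3 - 2 k) y^2 \\ - (1 - k) (1 + (3 - k) k) y^3\bigr) + x^2 (1 - y)^2 \bigl(3 - (2 + 4 k) y + (1 - k + 3 k^2) y^2 + k^2 (1 - k ) y^3\bigr)\Bigr) \end{multline*} and \begin{multline*} q(x,y)= 1 - x \Bigl(5 - 12 (2 - k) y + x^2 (1 - y)^2 \bigl(3 - (2 + 4 k) y + k (1 + 2 k) y^2 + k (1 - k ) y^3 - (k - 1)^4 y^4\bigr) \\ - x (1 - y) \bigl(7 - (25 - 8 k) y + (20 - 3 k - 4 k^2) y^2 + (5 - 24 k + 21 k^2 - 5 k^3) y^3 - (7 - 18 k + 17 k^2 - 7 k^3 + k^4) y^4\bigr) \\ + y^2 \bigl(32 - 26 k + 6 k^2 - (13 - 14 k + 6 k^2 - k^3) y\bigr)\Bigr). \end{multline*} Moreover, $[x^n]T(x,1)=k^{3n}$ for all $n\ge 1$.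
   Context: $K_m$ is the complete graph on $m$ vertices and $P_n$ the path graph on $n$ vertices. The product $G_1\times G_2$ of graphs $G_1=(V_1,E_1)$, $G_2=(V_2,E_2)$ is the Cartesian product: its vertex set is $V_1\times V_2$, and $(v_1,v_2),(w_1,w_2)$ are adjacent iff ($v_1=w_1$ and $\{v_2,w_2\}\in E_2$) or ($v_2=w_2$ and $\{v_1,w_1\}\in E_1$). For a finite undirected graph $G=(V,E)$, two nonempty disjoint subsets $V_1,V_2\subseteq V$ are neighbors if there is an edge of $G$ with one endpoint in $V_1$ and the other in $V_2$. A $k$-colored partition of $G$ is a partition $V=\bigcup_{i=1}^s V_i$ together with an assignment of one of $k$ colors to each $V_i$ (all vertices of $V_i$ get that color), such that each $V_i$ induces a connected subgraph of $G$ and any two neighboring sets $V_i,V_j$ have different colors. The sets $V_i$ are the blocks, and the size $\rho(T)$ of a $k$-colored partition $T$ is its number of blocks. $\mathcal{T}^{(k)}(G)$ denotes the set of all $k$-colored partitions of $G$. Generating functions are formal power series in $x$ with coefficients polynomial in $y$; $[x^n]$ denotes coefficient extraction. *)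

theory Defs
  imports
    "HOL-Computational_Algebra.Computational_Algebra"
    "HOL-Library.Disjoint_Sets"
    "HOL-Library.FuncSet"
begin

text \<open>An undirected graph is a pair of its vertex set and its set of edges, each edge being
  an unordered pair of distinct vertices.\<close>

type_synonym 'a ugraph = "'a set \<times> 'a set set"

definition complete_graph :: "nat \<Rightarrow> nat ugraph" where
  "complete_graph m = ({..<m}, {{i, j} | i j. i < m \<and> j < m \<and> i \<noteq> j})"

definition path_graph :: "nat \<Rightarrow> nat ugraph" where
  "path_graph n = ({..<n}, {{i, Suc i} | i. Suc i < n})"

definition cartesian_product :: "'a ugraph \<Rightarrow> 'b ugraph \<Rightarrow> ('a \<times> 'b) ugraph" where
  "cartesian_product G H =
     (fst G \<times> fst H,
      {{(v1, v2), (w1, w2)} | v1 v2 w1 w2.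
         (v1, v2) \<in> fst G \<times> fst H \<and> (w1, w2) \<in> fst G \<times> fst H \<and>
         (v1 = w1 \<and> {v2, w2} \<in> snd H \<or> v2 = w2 \<and> {v1, w1} \<in> snd G)})"

definition induced_subgraph :: "'a ugraph \<Rightarrow> 'a set \<Rightarrow> 'a ugraph" where
  "induced_subgraph G S = (S, {e \<in> snd G. e \<subseteq> S})"

definition connected_graph :: "'a ugraph \<Rightarrow> bool" where
  "connected_graph G \<longleftrightarrow>
     fst G \<noteq> {} \<and> (\<forall>u\<in>fst G. \<forall>v\<in>fst G. (u, v) \<in> {(a, b). {a, b} \<in> snd G}\<^sup>*)"

definition neighbors :: "'a ugraph \<Rightarrow> 'a set \<Rightarrow> 'a set \<Rightarrow> bool" where
  "neighbors G A B \<longleftrightarrow>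
     A \<noteq> {} \<and> B \<noteq> {} \<and> A \<inter> B = {} \<and> (\<exists>a\<in>A. \<exists>b\<in>B. {a, b} \<in> snd G)"

text \<open>The colors are \<open>0, \<dots>, k - 1\<close>. The coloring is extensional on the set of blocks, so that
  each colored partition is represented by exactly one pair.\<close>

definition colored_partitions :: "nat \<Rightarrow> 'a ugraph \<Rightarrow> ('a set set \<times> ('a set \<Rightarrow> nat)) set" where
  "colored_partitions k G =
     {(P, c). partition_on (fst G) P \<and> c \<in> P \<rightarrow>\<^sub>E {..<k} \<and>
        (\<forall>A\<in>P. connected_graph (induced_subgraph G A)) \<and>
        (\<forall>A\<in>P. \<forall>B\<in>P. neighbors G A B \<longrightarrow> c A \<noteq> c B)}"

lemma finite_colored_partitions:
  assumes "finite (fst G)"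
  shows "finite (colored_partitions k G)"
proof (rule finite_subset)
  show "colored_partitions k G \<subseteq> Sigma {P. partition_on (fst G) P} (\<lambda>P. P \<rightarrow>\<^sub>E {..<k})"
    by (auto simp: colored_partitions_def)
  show "finite (Sigma {P. partition_on (fst G) P} (\<lambda>P. P \<rightarrow>\<^sub>E {..<k}))"
    using assms by (intro finite_SigmaI finitely_many_partition_on finite_PiE)
      (auto intro: finite_elements)
qed

definition partition_size :: "'a set set \<times> ('a set \<Rightarrow> nat) \<Rightarrow> nat" where
  "partition_size T = card (fst T)"

definition U :: "nat \<Rightarrow> (nat \<times> nat) ugraph" where
  "U n = cartesian_product (complete_graph 3) (path_graph n)"

text \<open>The power series variable is \<open>x\<close>, the polynomial variable of the coefficients is \<open>y\<close>.\<close>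

definition T_gf :: "nat \<Rightarrow> int poly fps" where
  "T_gf k = Abs_fps (\<lambda>n. if n = 0 then 0
     else (\<Sum>T\<in>colored_partitions k (U n). monom 1 (partition_size T)))"

text \<open>Division of power series is only available over a field, hence the embedding of the
  coefficient ring into its field of fractions.\<close>

definition fract_fps :: "'a :: idom fps \<Rightarrow> 'a fract fps" where
  "fract_fps F = Abs_fps (\<lambda>n. to_fract (fps_nth F n))"

definition p_xy :: "'a :: comm_ring_1 \<Rightarrow> 'a \<Rightarrow> 'a \<Rightarrow> 'a" where
  "p_xy k x y =
     k * x * y * (1 - (1 - k) * y * (3 - (2 - k) * y)
       - x * (1 - y) * (4 - y * (13 - 5 * k) + (3 + k) * (3 - 2 * k) * y^2
           - (1 - k) * (1 + (3 - k) * k) * y^3)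
       + x^2 * (1 - y)^2 * (3 - (2 + 4 * k) * y + (1 - k + 3 * k^2) * y^2
           + k^2 * (1 - k) * y^3))"

definition q_xy :: "'a :: comm_ring_1 \<Rightarrow> 'a \<Rightarrow> 'a \<Rightarrow> 'a" where
  "q_xy k x y =
     1 - x * (5 - 12 * (2 - k) * y
       + x^2 * (1 - y)^2 * (3 - (2 + 4 * k) * y + k * (1 + 2 * k) * y^2
           + k * (1 - k) * y^3 - (k - 1)^4 * y^4)
       - x * (1 - y) * (7 - (25 - 8 * k) * y + (20 - 3 * k - 4 * k^2) * y^2
           + (5 - 24 * k + 21 * k^2 - 5 * k^3) * y^3
           - (7 - 18 * k + 17 * k^2 - 7 * k^3 + k^4) * y^4)
       + y^2 * (32 - 26 * k + 6 * k^2 - (13 - 14 * k + 6 * k^2 - k^3) * y))"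

end

theory Submission
  imports Defs
begin

text \<open>
  Colored partitions of a graph correspond to arbitrary colorings of its vertices: the blocks are
  the connected components of the monochromatic subgraphs. In \<open>K\<^sub>m \<times> P\<^sub>n\<close> two vertices
  of equal color in the same column are adjacent, so a walk that leaves a column and comes back can
  be shortcut inside it. Hence appending a column creates exactly one new component for each of its
  colors that no row carries over from the preceding column. The colorings can therefore be counted
  by a transfer matrix indexed by columns, and for \<open>m = 3\<close>, by symmetry, by the number (one, two or
  three) of colors of a column. The reciprocal characteristic polynomial of the resulting
  3 by 3 matrix is \<open>q\<close>.
\<close>

section \<open>Colored partitions as colorings\<close>

text \<open>A \<open>ugraph\<close> is an arbitrary pair, so edges might leave the vertex set; the
  membership conditions keep walks inside it.\<close>

definition mono_edges :: "'a ugraph \<Rightarrow> ('a \<Rightarrow> 'c) \<Rightarrow> 'a rel" where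
  "mono_edges G f = {(u, v). u \<in> fst G \<and> v \<in> fst G \<and> {u, v} \<in> snd G \<and> f u = f v}"

definition mono_class :: "'a ugraph \<Rightarrow> ('a \<Rightarrow> 'c) \<Rightarrow> 'a \<Rightarrow> 'a set" where
  "mono_class G f v = (mono_edges G f)\<^sup>* `` {v}"

definition mono_components :: "'a ugraph \<Rightarrow> ('a \<Rightarrow> 'c) \<Rightarrow> 'a set set" where
  "mono_components G f = mono_class G f ` fst G"

lemma mono_components_cong:
  assumes "\<And>v. v \<in> fst G \<Longrightarrow> f v = g v"
  shows "mono_components G f = mono_components G g"
proof -
  have "mono_edges G f = mono_edges G g"
    using assms by (auto simp: mono_edges_def)
  then show ?thesis by (simp add: mono_components_def mono_class_def)
qed

lemma sym_mono_edges: "sym (mono_edges G f)"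
  by (auto simp: mono_edges_def sym_def insert_commute)

lemma mono_walk_sym: "(u, v) \<in> (mono_edges G f)\<^sup>* \<Longrightarrow> (v, u) \<in> (mono_edges G f)\<^sup>*"
  by (rule symD[OF sym_rtrancl[OF sym_mono_edges]])

lemma mono_walk_color: "(u, v) \<in> (mono_edges G f)\<^sup>* \<Longrightarrow> f u = f v"
  by (induction rule: rtrancl_induct) (auto simp: mono_edges_def)

lemma mono_walk_in: "(u, v) \<in> (mono_edges G f)\<^sup>* \<Longrightarrow> u \<in> fst G \<Longrightarrow> v \<in> fst G"
  by (induction rule: rtrancl_induct) (auto simp: mono_edges_def)

lemma mono_class_eq_iff: "mono_class G f u = mono_class G f v \<longleftrightarrow> (u, v) \<in> (mono_edges G f)\<^sup>*"
  unfolding mono_class_def by (auto dest: mono_walk_sym intro: rtrancl_trans)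

lemma mono_class_eqI: "w \<in> mono_class G f v \<Longrightarrow> mono_class G f v = mono_class G f w"
  unfolding mono_class_eq_iff by (simp add: mono_class_def)

lemma self_in_mono_class: "v \<in> mono_class G f v"
  by (simp add: mono_class_def)

lemma mono_class_subset: "v \<in> fst G \<Longrightarrow> mono_class G f v \<subseteq> fst G"
  by (auto simp: mono_class_def intro: mono_walk_in)

lemma mono_class_color: "w \<in> mono_class G f v \<Longrightarrow> f w = f v"
  by (auto simp: mono_class_def dest: mono_walk_color)

lemma partition_on_mono_components: "partition_on (fst G) (mono_components G f)"
proof (rule partition_onI)
  show "\<Union> (mono_components G f) = fst G"
    unfolding mono_components_def using mono_class_subset self_in_mono_class by fast
  show "disjnt A B" if "A \<in> mono_components G f" "B \<in> mono_components G f" "A \<noteq> B" for A B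
    using that unfolding mono_components_def disjnt_iff by (metis imageE mono_class_eqI)
  show "{} \<notin> mono_components G f"
    unfolding mono_components_def using self_in_mono_class by (metis empty_iff imageE)
qed

lemma connected_mono_class:
  assumes "v \<in> fst G"
  shows "connected_graph (induced_subgraph G (mono_class G f v))"
proof -
  let ?A = "mono_class G f v"
  \<comment> \<open>The induction carries membership of the endpoint along: an edge survives in the
    induced subgraph only if both its ends lie in the class.\<close>
  have walk: "(u, w) \<in> {(a, b). {a, b} \<in> snd (induced_subgraph G ?A)}\<^sup>* \<and> w \<in> ?A"
    if "(u, w) \<in> (mono_edges G f)\<^sup>*" "u \<in> ?A" for u w
    using that
  proof (induction rule: rtrancl_induct)
    case (step x z)
    then have "z \<in> ?A"
      by (auto simp: mono_class_def)
    with step show ?case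
      by (auto simp: mono_edges_def induced_subgraph_def intro: rtrancl_into_rtrancl)
  qed auto
  have fst_A: "fst (induced_subgraph G ?A) = ?A"
    by (simp add: induced_subgraph_def)
  show ?thesis
    unfolding connected_graph_def fst_A
  proof (intro conjI ballI)
    show "?A \<noteq> {}" using self_in_mono_class[of v G f] by blast
    fix u w assume uw: "u \<in> ?A" "w \<in> ?A"
    then have "(u, w) \<in> (mono_edges G f)\<^sup>*" by (metis mono_class_eq_iff mono_class_eqI)
    with walk uw show "(u, w) \<in> {(a, b). {a, b} \<in> snd (induced_subgraph G ?A)}\<^sup>*" by blast
  qed
qed

text \<open>A monochromatic walk cannot leave a block, since its first edge out would join
  neighboring blocks of equal color. Conversely, a block is connected by edges that are all
  monochromatic.\<close>

lemma mono_components_eq_blocks: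
  assumes T: "(P, c) \<in> colored_partitions k G"
    and f: "\<And>A v. A \<in> P \<Longrightarrow> v \<in> A \<Longrightarrow> f v = c A"
  shows "mono_components G f = P"
proof -
  have part: "partition_on (fst G) P"
    and conn: "\<And>A. A \<in> P \<Longrightarrow> connected_graph (induced_subgraph G A)"
    and nb: "\<And>A B. A \<in> P \<Longrightarrow> B \<in> P \<Longrightarrow> neighbors G A B \<Longrightarrow> c A \<noteq> c B"
    using T by (auto simp: colored_partitions_def)
  have sub: "A \<subseteq> fst G" if "A \<in> P" for A
    using partition_onD1[OF part] that by blast
  have class_eq: "mono_class G f v = A" if A: "A \<in> P" "v \<in> A" for A v
  proof
    have "w \<in> A" if "(v, w) \<in> (mono_edges G f)\<^sup>*" for w
      using that
    proof (induction rule: rtrancl_induct)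
      case (step x z)
      then have z: "z \<in> fst G" "{x, z} \<in> snd G" "f x = f z"
        by (auto simp: mono_edges_def)
      then obtain B where B: "B \<in> P" "z \<in> B"
        using partition_onD1[OF part] by blast
      show ?case
      proof (rule ccontr)
        assume "z \<notin> A"
        then have "A \<inter> B = {}"
          using B A partition_onD2[OF part] by (metis disjointD)
        then have "neighbors G A B"
          using A B step.IH z by (auto simp: neighbors_def)
        from nb[OF A(1) B(1) this] f[OF A(1) step.IH] f[OF B] z show False by simp
      qed
    qed (use A in simp)
    then show "mono_class G f v \<subseteq> A" by (auto simp: mono_class_def)
    have "{(a, b). {a, b} \<in> snd (induced_subgraph G A)} \<subseteq> mono_edges G f"
      using f A sub by (auto simp: mono_edges_def induced_subgraph_def)
    from rtrancl_mono[OF this] show "A \<subseteq> mono_class G f v"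
      using conn[OF A(1)] A(2) by (auto simp: mono_class_def connected_graph_def induced_subgraph_def)
  qed
  show ?thesis
  proof
    show "mono_components G f \<subseteq> P"
      using class_eq partition_onD1[OF part] by (auto simp: mono_components_def)
    show "P \<subseteq> mono_components G f"
    proof
      fix A assume A: "A \<in> P"
      then obtain v where "v \<in> A" using partition_onD3[OF part] by (metis ex_in_conv)
      with A class_eq sub show "A \<in> mono_components G f"
        by (auto simp: mono_components_def intro!: image_eqI[of _ _ v])
    qed
  qed
qed

text \<open>Two neighboring components of equal color would be joined by a monochromatic edge and
  hence coincide.\<close>

lemma mono_components_colored_partition:
  assumes c: "c \<in> mono_components G f \<rightarrow>\<^sub>E {..<k}"
    and col: "\<And>A v. A \<in> mono_components G f \<Longrightarrow> v \<in> A \<Longrightarrow> c A = f v"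
  shows "(mono_components G f, c) \<in> colored_partitions k G"
proof -
  have "c A \<noteq> c B" if A: "A \<in> mono_components G f" and B: "B \<in> mono_components G f"
    and nb: "neighbors G A B" for A B
  proof
    assume eq: "c A = c B"
    obtain a b where ab: "a \<in> A" "b \<in> B" "{a, b} \<in> snd G" "A \<inter> B = {}"
      using nb by (auto simp: neighbors_def)
    have sub: "A \<subseteq> fst G" "B \<subseteq> fst G"
      using A B partition_onD1[OF partition_on_mono_components[of G f]] by auto
    have "f a = f b" using col[OF A ab(1)] col[OF B ab(2)] eq by simp
    then have "(a, b) \<in> mono_edges G f" using ab sub by (auto simp: mono_edges_def)
    then have "mono_class G f a = mono_class G f b" unfolding mono_class_eq_iff by blast
    moreover have "A = mono_class G f a" "B = mono_class G f b"
      using A B ab by (auto simp: mono_components_def dest: mono_class_eqI)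
    ultimately show False using ab by auto
  qed
  moreover have "connected_graph (induced_subgraph G A)" if "A \<in> mono_components G f" for A
    using that by (auto simp: mono_components_def intro: connected_mono_class)
  ultimately show ?thesis
    using partition_on_mono_components[of G f] c by (simp add: colored_partitions_def)
qed

text \<open>Coloring vertices by their blocks and taking monochromatic components are mutually
  inverse. Since \<open>h\<close> is arbitrary, this serves both the weighted sum and the plain
  count.\<close>

lemma sum_colored_partitions:
  fixes G :: "'v ugraph"
  shows "(\<Sum>T\<in>colored_partitions k G. h (fst T)) = (\<Sum>f\<in>fst G \<rightarrow>\<^sub>E {..<k}. h (mono_components G f))"
proof -
  define coloring :: "'v set set \<times> ('v set \<Rightarrow> nat) \<Rightarrow> 'v \<Rightarrow> nat" where
    "coloring = (\<lambda>T. \<lambda>v\<in>fst G. snd T (THE A. A \<in> fst T \<and> v \<in> A))"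
  \<comment> \<open>The choice by \<open>SOME\<close> is harmless because components are
    monochromatic (\<open>color_comp\<close>).\<close>
  define blocks :: "('v \<Rightarrow> nat) \<Rightarrow> 'v set set \<times> ('v set \<Rightarrow> nat)" where
    "blocks = (\<lambda>f. (mono_components G f, \<lambda>A\<in>mono_components G f. f (SOME v. v \<in> A)))"
  have the_block: "(THE A. A \<in> P \<and> v \<in> A) = A"
    if "partition_on (fst G) P" "A \<in> P" "v \<in> A" for P A v
    using that partition_onD2[OF that(1)] by (intro the_equality) (auto dest: disjointD)
  have coloring: "coloring (P, c) v = c A"
    if "(P, c) \<in> colored_partitions k G" "A \<in> P" "v \<in> A" for P c A v
  proof -
    have part: "partition_on (fst G) P" using that by (auto simp: colored_partitions_def)
    with that have "v \<in> fst G" by (auto dest: partition_onD1)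
    with the_block[OF part] that show ?thesis by (simp add: coloring_def)
  qed
  have comps: "mono_components G (coloring (P, c)) = P"
    if "(P, c) \<in> colored_partitions k G" for P c
    using mono_components_eq_blocks[OF that] coloring[OF that] by blast
  have color_comp: "f (SOME v. v \<in> A) = f v"
    if "A \<in> mono_components G f" "v \<in> A" for f :: "'v \<Rightarrow> nat" and A v
  proof -
    have "(SOME v. v \<in> A) \<in> A" using that by (metis someI)
    with that show ?thesis
      by (auto simp: mono_components_def dest!: mono_class_color)
  qed
  have blocks_mem: "blocks f \<in> colored_partitions k G" if f: "f \<in> fst G \<rightarrow>\<^sub>E {..<k}" for f
    unfolding blocks_def
  proof (rule mono_components_colored_partition)
    have "f (SOME v. v \<in> A) < k" if A: "A \<in> mono_components G f" for A
    proof -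
      obtain v where "v \<in> fst G" "v \<in> A"
        using A self_in_mono_class unfolding mono_components_def by (metis imageE)
      then show ?thesis using f color_comp[OF A] by auto
    qed
    then show "(\<lambda>A\<in>mono_components G f. f (SOME v. v \<in> A)) \<in> mono_components G f \<rightarrow>\<^sub>E {..<k}"
      by auto
  qed (use color_comp in auto)
  show ?thesis
  proof (rule sum.reindex_bij_witness[where i = blocks and j = coloring])
    fix T assume T: "T \<in> colored_partitions k G"
    obtain P c where Pc: "T = (P, c)" by (cases T)
    note PcT = T[unfolded Pc]
    have part: "partition_on (fst G) P" and c: "c \<in> P \<rightarrow>\<^sub>E {..<k}"
      using PcT by (auto simp: colored_partitions_def)
    have "(\<lambda>A\<in>P. coloring (P, c) (SOME v. v \<in> A)) = c"
    proof
      fix A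
      show "(\<lambda>A\<in>P. coloring (P, c) (SOME v. v \<in> A)) A = c A"
      proof (cases "A \<in> P")
        case True
        then have "(SOME v. v \<in> A) \<in> A"
          using partition_onD3[OF part] by (metis some_in_eq)
        then show ?thesis using coloring[OF PcT] True by simp
      next
        case False
        then show ?thesis using c by (auto simp: PiE_def extensional_def)
      qed
    qed
    with comps[OF PcT] show "blocks (coloring T) = T"
      by (simp add: blocks_def Pc)
    show "coloring T \<in> fst G \<rightarrow>\<^sub>E {..<k}"
    proof
      fix v assume "v \<in> fst G"
      then obtain A where "A \<in> P" "v \<in> A" using partition_onD1[OF part] by blast
      with coloring[OF PcT] c show "coloring T v \<in> {..<k}" by (auto simp: Pc)
    qed (simp add: coloring_def)
    show "h (mono_components G (coloring T)) = h (fst T)"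
      by (simp add: Pc comps[OF PcT])
  next
    fix f assume f: "f \<in> fst G \<rightarrow>\<^sub>E {..<k}"
    show "blocks f \<in> colored_partitions k G" by (rule blocks_mem[OF f])
    show "coloring (blocks f) = f"
    proof
      fix v
      show "coloring (blocks f) v = f v"
      proof (cases "v \<in> fst G")
        case True
        then have A: "mono_class G f v \<in> mono_components G f" by (simp add: mono_components_def)
        from coloring[OF blocks_mem[OF f, unfolded blocks_def] A self_in_mono_class]
          color_comp[OF A self_in_mono_class] A
        show ?thesis by (simp add: blocks_def)
      next
        case False
        then show ?thesis using f by (auto simp: coloring_def PiE_def extensional_def)
      qed
    qed
  qed
qed

section \<open>Components of colored prisms\<close>

text \<open>The component count works for every height \<open>m\<close>; \<open>U n\<close> is
  \<open>prism 3 n\<close>, and \<open>n = 0\<close> gives the empty graph from which columns are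
  added.\<close>

definition prism :: "nat \<Rightarrow> nat \<Rightarrow> (nat \<times> nat) ugraph" where
  "prism m n = cartesian_product (complete_graph m) (path_graph n)"

lemma fst_prism: "fst (prism m n) = {..<m} \<times> {..<n}"
  by (simp add: prism_def cartesian_product_def complete_graph_def path_graph_def)

lemma edge_cartesian_product_iff:
  "{(v1, v2), (w1, w2)} \<in> snd (cartesian_product G H) \<longleftrightarrow>
     (v1, v2) \<in> fst G \<times> fst H \<and> (w1, w2) \<in> fst G \<times> fst H \<and>
     (v1 = w1 \<and> {v2, w2} \<in> snd H \<or> v2 = w2 \<and> {v1, w1} \<in> snd G)" (is "?L \<longleftrightarrow> ?R")
proof
  show "?L \<Longrightarrow> ?R"
    by (auto simp: cartesian_product_def doubleton_eq_iff insert_commute)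
  show "?R \<Longrightarrow> ?L"
    unfolding cartesian_product_def by auto
qed

lemma edge_prism_iff:
  "{(i, j), (i', j')} \<in> snd (prism m n) \<longleftrightarrow>
     i < m \<and> i' < m \<and> j < n \<and> j' < n \<and>
     (i = i' \<and> (j' = Suc j \<or> j = Suc j') \<or> j = j' \<and> i \<noteq> i')"
  unfolding prism_def edge_cartesian_product_iff
  by (auto simp: complete_graph_def path_graph_def doubleton_eq_iff)

lemma mono_edges_prism_iff:
  "((i, j), (i', j')) \<in> mono_edges (prism m n) f \<longleftrightarrow>
     i < m \<and> i' < m \<and> j < n \<and> j' < n \<and> f (i, j) = f (i', j') \<and>
     (i = i' \<and> (j' = Suc j \<or> j = Suc j') \<or> j = j' \<and> i \<noteq> i')"
  by (auto simp: mono_edges_def fst_prism edge_prism_iff)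

text \<open>In the first column every color is fresh. The guard \<open>0 < n\<close> ensures this:
  there \<open>n - 1\<close> truncates to \<open>n\<close>, and the column would match
  itself.\<close>

definition fresh_colors :: "nat \<Rightarrow> nat \<Rightarrow> (nat \<times> nat \<Rightarrow> 'c) \<Rightarrow> 'c set" where
  "fresh_colors m n f =
     (\<lambda>i. f (i, n)) ` {..<m} - {f (i, n) | i. i < m \<and> 0 < n \<and> f (i, n - 1) = f (i, n)}"

text \<open>Both images are quotients of \<open>A\<close> by the same equivalence relation.\<close>

lemma card_image_eqI:
  assumes "\<And>u v. u \<in> A \<Longrightarrow> v \<in> A \<Longrightarrow> g u = g v \<longleftrightarrow> h u = h v"
  shows "card (g ` A) = card (h ` A)"
proof -
  define F where "F = (\<lambda>x. h (inv_into A g x))"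
  have F: "F (g u) = h u" if "u \<in> A" for u
    using that assms by (metis F_def f_inv_into_f imageI inv_into_into)
  have "inj_on F (g ` A)"
    using F assms by (auto simp: inj_on_def)
  moreover have "F ` g ` A = h ` A"
    using F by (force simp: image_iff)
  ultimately show ?thesis by (metis card_image)
qed

lemma mono_walk_same_column:
  assumes "i < m" "i' < m" "j < n" "f (i, j) = f (i', j)"
  shows "((i, j), (i', j)) \<in> (mono_edges (prism m n) f)\<^sup>*"
  using assms by (cases "i = i'") (auto intro!: r_into_rtrancl simp: mono_edges_prism_iff)

text \<open>An excursion into the new column joins no old vertices that were not joined before. The
  second conjunct is the invariant during an excursion: it remembers a row that carries the color
  over and whose vertex in column \<open>n - 1\<close> is reachable in the old prism.\<close>

lemma mono_walk_prism_Suc: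
  assumes "(u, w) \<in> (mono_edges (prism m (Suc n)) f)\<^sup>*" and "u \<in> fst (prism m n)"
  shows "(snd w < n \<longrightarrow> (u, w) \<in> (mono_edges (prism m n) f)\<^sup>*) \<and>
    (snd w = n \<longrightarrow> (\<exists>i<m. 0 < n \<and> f (i, n - 1) = f w \<and> f (i, n) = f w \<and>
       (u, (i, n - 1)) \<in> (mono_edges (prism m n) f)\<^sup>*))"
  using assms(1)
proof (induction rule: rtrancl_induct)
  case base
  then show ?case using assms(2) by (auto simp: fst_prism)
next
  case (step w w')
  let ?R = "mono_edges (prism m n) f"
  obtain i j i' j' where w: "w = (i, j)" "w' = (i', j')" by (metis surj_pair)
  have e: "i < m" "i' < m" "j < Suc n" "j' < Suc n" "f (i, j) = f (i', j')"
    "i = i' \<and> (j' = Suc j \<or> j = Suc j') \<or> j = j' \<and> i \<noteq> i'"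
    using step.hyps(2) by (auto simp: w mono_edges_prism_iff)
  consider "j < n" "j' < n" | "j < n" "j' = n" | "j = n" "j' < n" | "j = n" "j' = n"
    using e by linarith
  then show ?case
  proof cases
    case 1
    then have "(w, w') \<in> ?R" using e by (auto simp: w mono_edges_prism_iff)
    with step.IH 1 show ?thesis by (auto simp: w intro: rtrancl_into_rtrancl)
  next
    case 2
    then have "i' = i" "j = n - 1" "0 < n" using e by auto
    with step.IH 2 e show ?thesis by (auto simp: w)
  next
    \<comment> \<open>The walk may return in another row than the remembered one, but the two
      vertices of column \<open>n - 1\<close> have equal color and are therefore adjacent or
      equal.\<close>
    case 3
    then have j: "i' = i" "j' = n - 1" "0 < n" using e by auto
    obtain l where l: "l < m" "f (l, n - 1) = f w" "(u, (l, n - 1)) \<in> ?R\<^sup>*"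
      using step.IH 3 by (auto simp: w)
    have "((l, n - 1), w') \<in> ?R\<^sup>*"
      unfolding w j using l e j by (intro mono_walk_same_column) (auto simp: w)
    with l 3 show ?thesis by (auto simp: w intro: rtrancl_trans)
  next
    case 4
    with step.IH e show ?thesis by (auto simp: w)
  qed
qed

text \<open>Old vertices are joined in the larger prism only if they already were; new vertices of
  fresh color are never joined to old ones, and are joined to each other exactly when their colors
  agree.\<close>

lemma card_mono_components_prism_Suc:
  "card (mono_components (prism m (Suc n)) f) =
     card (mono_components (prism m n) f) + card (fresh_colors m n f)"
proof -
  let ?R = "mono_edges (prism m n) f" and ?R' = "mono_edges (prism m (Suc n)) f"
  let ?c = "mono_class (prism m n) f" and ?c' = "mono_class (prism m (Suc n)) f"
  let ?V = "{..<m} \<times> {..<n}"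
  define N where "N = {v \<in> {..<m} \<times> {n}. f v \<in> fresh_colors m n f}"
  have "?R \<subseteq> ?R'" by (auto simp: mono_edges_prism_iff)
  then have R_R': "?R\<^sup>* \<subseteq> ?R'\<^sup>*" by (rule rtrancl_mono)
  \<comment> \<open>A color that is not fresh is carried over in some row \<open>l\<close>, so the
    vertex reaches the old prism through \<open>(l, n)\<close> and
    \<open>(l, n - 1)\<close>.\<close>
  have old_or_new: "?c' (i, n) \<in> ?c' ` ?V \<union> ?c' ` N" if i: "i < m" for i
  proof (cases "f (i, n) \<in> fresh_colors m n f")
    case True
    with i show ?thesis by (auto simp: N_def)
  next
    case False
    then obtain l where l: "l < m" "0 < n" "f (l, n - 1) = f (i, n)" "f (l, n) = f (i, n)"
      using i by (auto simp: fresh_colors_def)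
    have "((i, n), (l, n)) \<in> ?R'\<^sup>*"
      using i l by (intro mono_walk_same_column) auto
    moreover have "((l, n), (l, n - 1)) \<in> ?R'"
      using l by (auto simp: mono_edges_prism_iff)
    ultimately have "?c' (i, n) = ?c' (l, n - 1)"
      unfolding mono_class_eq_iff by (rule rtrancl_into_rtrancl)
    with l show ?thesis by auto
  qed
  have "mono_components (prism m (Suc n)) f = ?c' ` ?V \<union> ?c' ` N"
  proof
    show "mono_components (prism m (Suc n)) f \<subseteq> ?c' ` ?V \<union> ?c' ` N"
    proof
      fix A assume "A \<in> mono_components (prism m (Suc n)) f"
      then obtain i j where "i < m" "j < n \<or> j = n" "A = ?c' (i, j)"
        by (auto simp: mono_components_def fst_prism less_Suc_eq)
      with old_or_new show "A \<in> ?c' ` ?V \<union> ?c' ` N" by auto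
    qed
    show "?c' ` ?V \<union> ?c' ` N \<subseteq> mono_components (prism m (Suc n)) f"
      by (auto simp: mono_components_def fst_prism N_def)
  qed
  moreover have "?c' ` ?V \<inter> ?c' ` N = {}"
  proof -
    have False if "u \<in> ?V" "v \<in> N" "?c' u = ?c' v" for u v
    proof -
      have "(u, v) \<in> ?R'\<^sup>*" using that by (simp only: mono_class_eq_iff)
      from mono_walk_prism_Suc[OF this] that obtain l
        where "l < m" "0 < n" "f (l, n - 1) = f v" "f (l, n) = f v"
        by (auto simp: fst_prism N_def)
      then have "f v \<notin> fresh_colors m n f" by (force simp: fresh_colors_def)
      with that show False by (simp add: N_def)
    qed
    then show ?thesis by auto
  qed
  moreover have "card (?c' ` ?V) = card (?c ` ?V)"
  proof (rule card_image_eqI)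
    fix u v assume "u \<in> ?V" "v \<in> ?V"
    then show "?c' u = ?c' v \<longleftrightarrow> ?c u = ?c v"
      unfolding mono_class_eq_iff using R_R' mono_walk_prism_Suc[of u v m n f]
      by (auto simp: fst_prism)
  qed
  moreover have "card (?c' ` N) = card (f ` N)"
  proof (rule card_image_eqI)
    fix u v assume "u \<in> N" "v \<in> N"
    then show "?c' u = ?c' v \<longleftrightarrow> f u = f v"
      unfolding mono_class_eq_iff
      by (auto simp: N_def intro: mono_walk_same_column dest: mono_walk_color)
  qed
  moreover have "f ` N = fresh_colors m n f"
    by (auto simp: N_def fresh_colors_def)
  moreover have "finite N" by (auto simp: N_def)
  ultimately show ?thesis
    by (simp add: card_Un_disjoint mono_components_def fst_prism)
qed

section \<open>Splitting off the last column: the transfer recursion\<close>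

definition append_column :: "nat \<Rightarrow> (nat \<times> nat \<Rightarrow> 'c) \<Rightarrow> (nat \<Rightarrow> 'c) \<Rightarrow> nat \<times> nat \<Rightarrow> 'c" where
  "append_column n f g = (\<lambda>(i, j). if j = n then g i else f (i, j))"

lemma sum_PiE_append_column:
  "(\<Sum>F\<in>{..<m} \<times> {..<Suc n} \<rightarrow>\<^sub>E S. H F) =
     (\<Sum>f\<in>{..<m} \<times> {..<n} \<rightarrow>\<^sub>E S. \<Sum>g\<in>{..<m} \<rightarrow>\<^sub>E S. H (append_column n f g))"
proof -
  let ?split = "\<lambda>F. (restrict F ({..<m} \<times> {..<n}), restrict (\<lambda>i. F (i, n)) {..<m})"
  show ?thesis
    unfolding sum.cartesian_product
  proof (rule sum.reindex_bij_witness[where i = "\<lambda>(f, g). append_column n f g" and j = ?split])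
    fix F assume F: "F \<in> {..<m} \<times> {..<Suc n} \<rightarrow>\<^sub>E S"
    have undef: "F (i, j) = undefined" if "\<not> (i < m \<and> j < Suc n)" for i j
      using F that by (intro PiE_arb[OF F]) auto
    have "append_column n (restrict F ({..<m} \<times> {..<n})) (restrict (\<lambda>i. F (i, n)) {..<m}) = F"
    proof
      fix v :: "nat \<times> nat"
      obtain i j where v: "v = (i, j)" by (cases v)
      show "append_column n (restrict F ({..<m} \<times> {..<n})) (restrict (\<lambda>i. F (i, n)) {..<m}) v = F v"
        using undef[of i j] by (auto simp: v append_column_def)
    qed
    then show "(case ?split F of (f, g) \<Rightarrow> append_column n f g) = F"
      and "(case ?split F of (f, g) \<Rightarrow> H (append_column n f g)) = H F"
      by simp_all
    show "?split F \<in> ({..<m} \<times> {..<n} \<rightarrow>\<^sub>E S) \<times> ({..<m} \<rightarrow>\<^sub>E S)"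
      using F by (auto intro!: restrict_PiE_iff[THEN iffD2] PiE_mem[OF F])
  next
    fix fg assume fg: "fg \<in> ({..<m} \<times> {..<n} \<rightarrow>\<^sub>E S) \<times> ({..<m} \<rightarrow>\<^sub>E S)"
    obtain f g where fg_eq: "fg = (f, g)" by (cases fg)
    have f: "f \<in> {..<m} \<times> {..<n} \<rightarrow>\<^sub>E S" and g: "g \<in> {..<m} \<rightarrow>\<^sub>E S"
      using fg by (auto simp: fg_eq)
    have "restrict (append_column n f g) ({..<m} \<times> {..<n}) = restrict f ({..<m} \<times> {..<n})"
      by (auto simp: append_column_def restrict_def)
    moreover have "restrict (\<lambda>i. append_column n f g (i, n)) {..<m} = restrict g {..<m}"
      by (auto simp: append_column_def)
    ultimately show "?split (case fg of (f, g) \<Rightarrow> append_column n f g) = fg"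
      using f g by (simp add: fg_eq PiE_restrict)
    have "append_column n f g \<in> {..<m} \<times> {..<Suc n} \<rightarrow>\<^sub>E S"
    proof (rule PiE_I)
      fix v assume "v \<in> {..<m} \<times> {..<Suc n}"
      then show "append_column n f g v \<in> S"
        using PiE_mem[OF f] PiE_mem[OF g] by (auto simp: append_column_def less_Suc_eq)
    next
      fix v assume "v \<notin> {..<m} \<times> {..<Suc n}"
      then show "append_column n f g v = undefined"
        using PiE_arb[OF f] PiE_arb[OF g] by (cases v) (auto simp: append_column_def)
    qed
    then show "(case fg of (f, g) \<Rightarrow> append_column n f g) \<in> {..<m} \<times> {..<Suc n} \<rightarrow>\<^sub>E S"
      by (simp add: fg_eq)
  qed
qed

text \<open>Index \<open>n\<close> belongs to \<open>n + 1\<close> columns, the last being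
  \<open>g\<close>; the exponent is the number of components of the whole coloring.\<close>

definition column_weight :: "'a::comm_semiring_1 \<Rightarrow> nat \<Rightarrow> nat \<Rightarrow> nat \<Rightarrow> (nat \<Rightarrow> nat) \<Rightarrow> 'a" where
  "column_weight y k m n g =
     (\<Sum>f\<in>{..<m} \<times> {..<n} \<rightarrow>\<^sub>E {..<k}.
        y ^ (card (mono_components (prism m n) f) + card (fresh_colors m n (append_column n f g))))"

text \<open>The fresh colors of a column \<open>g\<close> after a column \<open>h\<close>. That they
  depend on these two columns alone makes a transfer matrix possible.\<close>

definition unmatched :: "nat \<Rightarrow> (nat \<Rightarrow> 'c) \<Rightarrow> (nat \<Rightarrow> 'c) \<Rightarrow> 'c set" where
  "unmatched m h g = g ` {..<m} - {g i | i. i < m \<and> h i = g i}"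

lemma column_weight_0: "column_weight y k m 0 g = y ^ card (g ` {..<m})"
  by (simp add: column_weight_def mono_components_def fst_prism fresh_colors_def append_column_def)

lemma card_mono_components_append_column:
  "card (mono_components (prism m (Suc n)) (append_column n f g)) =
     card (mono_components (prism m n) f) + card (fresh_colors m n (append_column n f g))"
proof -
  have "mono_components (prism m n) (append_column n f g) = mono_components (prism m n) f"
    by (rule mono_components_cong) (auto simp: fst_prism append_column_def)
  then show ?thesis by (simp add: card_mono_components_prism_Suc)
qed

text \<open>Once the preceding column \<open>h\<close> is fixed, the factor for the fresh colors
  leaves the sum over the earlier columns.\<close>

lemma column_weight_Suc:
  "column_weight y k m (Suc n) g =
     (\<Sum>h\<in>{..<m} \<rightarrow>\<^sub>E {..<k}. column_weight y k m n h * y ^ card (unmatched m h g))"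
proof -
  have fresh: "fresh_colors m (Suc n) (append_column (Suc n) (append_column n f h) g) = unmatched m h g" for f h
    by (simp add: fresh_colors_def unmatched_def append_column_def)
  show ?thesis
    unfolding column_weight_def[of y k m "Suc n"] sum_PiE_append_column
      card_mono_components_append_column fresh
    by (subst sum.swap) (simp add: column_weight_def sum_distrib_right power_add)
qed

lemma sum_power_mono_components_prism_Suc:
  "(\<Sum>f\<in>fst (prism m (Suc n)) \<rightarrow>\<^sub>E {..<k}. y ^ card (mono_components (prism m (Suc n)) f)) =
     (\<Sum>g\<in>{..<m} \<rightarrow>\<^sub>E {..<k}. column_weight y k m n g)"
  unfolding fst_prism sum_PiE_append_column card_mono_components_append_column
  by (subst sum.swap) (simp add: column_weight_def)

section \<open>The recursion for \<open>K\<^sub>3 \<times> P\<^sub>n\<close>\<close>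

text \<open>
  The entries are the weights of a column with one, two and three colors. If \<open>h\<close> is the preceding
  column, \<open>s0\<close> and \<open>s1\<close> sum the weights over all \<open>h\<close> with no and one prescribed entry; \<open>s2\<close> and
  \<open>s2'\<close> prescribe two entries, equal and distinct ones. The coefficients of these sums come from expanding
  \<open>y ^ card (unmatched 3 h g)\<close> in the indicators of \<open>h i = g i\<close>.
\<close>

primrec type_weights :: "'a::idom \<Rightarrow> 'a \<Rightarrow> nat \<Rightarrow> 'a \<times> 'a \<times> 'a" where
  "type_weights k y 0 = (y, y^2, y^3)"
| "type_weights k y (Suc n) =
     (case type_weights k y n of (a, b, c) \<Rightarrow>
       let z = 1 - y;
           s0 = k * a + 3 * k * (k - 1) * b + k * (k - 1) * (k - 2) * c;
           s1 = a + 3 * (k - 1) * b + (k - 1) * (k - 2) * c;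
           s2 = a + (k - 1) * b;
           s2' = 2 * b + (k - 2) * c
       in (y * s0 + 3 * z * s1 - 3 * z * s2 + z * a,
           y^2 * s0 + 3 * y * z * s1 - y * z * s2 + 2 * z^2 * s2' - z^2 * b,
           y^3 * s0 + 3 * y^2 * z * s1 + 3 * y * z^2 * s2' + z^3 * c))"

text \<open>The coefficients count the columns with one, two and three colors. Index
  \<open>n\<close> again stands for \<open>n + 1\<close> columns.\<close>

definition total_weight :: "'a::idom \<Rightarrow> 'a \<Rightarrow> nat \<Rightarrow> 'a" where
  "total_weight k y n = (case type_weights k y n of (a, b, c) \<Rightarrow>
     k * a + 3 * k * (k - 1) * b + k * (k - 1) * (k - 2) * c)"

text \<open>These polynomials and the ones below are the coefficients of \<open>x\<close>,
  \<open>x^2\<close>, \<open>x^3\<close> in \<open>q_xy\<close> and \<open>p_xy\<close>; see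
  \<open>q_xy_eq\<close> and \<open>p_xy_eq\<close>.\<close>

definition q_coeff1 :: "'a::idom \<Rightarrow> 'a \<Rightarrow> 'a" where
  "q_coeff1 k y = - (5 - 12 * (2 - k) * y + y^2 * (32 - 26 * k + 6 * k^2 - (13 - 14 * k + 6 * k^2 - k^3) * y))"

definition q_coeff2 :: "'a::idom \<Rightarrow> 'a \<Rightarrow> 'a" where
  "q_coeff2 k y = (1 - y) * (7 - (25 - 8 * k) * y + (20 - 3 * k - 4 * k^2) * y^2
           + (5 - 24 * k + 21 * k^2 - 5 * k^3) * y^3
           - (7 - 18 * k + 17 * k^2 - 7 * k^3 + k^4) * y^4)"

definition q_coeff3 :: "'a::idom \<Rightarrow> 'a \<Rightarrow> 'a" where
  "q_coeff3 k y = - ((1 - y)^2 * (3 - (2 + 4 * k) * y + k * (1 + 2 * k) * y^2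
           + k * (1 - k) * y^3 - (k - 1)^4 * y^4))"

definition p_coeff1 :: "'a::idom \<Rightarrow> 'a \<Rightarrow> 'a" where
  "p_coeff1 k y = k * y * (1 - (1 - k) * y * (3 - (2 - k) * y))"

definition p_coeff2 :: "'a::idom \<Rightarrow> 'a \<Rightarrow> 'a" where
  "p_coeff2 k y = - (k * y * (1 - y) * (4 - y * (13 - 5 * k) + (3 + k) * (3 - 2 * k) * y^2
     - (1 - k) * (1 + (3 - k) * k) * y^3))"

definition p_coeff3 :: "'a::idom \<Rightarrow> 'a \<Rightarrow> 'a" where
  "p_coeff3 k y = k * y * (1 - y)^2 * (3 - (2 + 4 * k) * y + (1 - k + 3 * k^2) * y^2
     + k^2 * (1 - k) * y^3)"

text \<open>The step of \<open>type_weights\<close> is linear in \<open>(a, b, c)\<close>, and this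
  is the Cayley-Hamilton relation of its matrix, verified by expansion for arbitrary
  \<open>a\<close>, \<open>b\<close>, \<open>c\<close>.\<close>

lemma total_weight_rec:
  "total_weight k y (Suc (Suc (Suc n))) + q_coeff1 k y * total_weight k y (Suc (Suc n))
     + q_coeff2 k y * total_weight k y (Suc n) + q_coeff3 k y * total_weight k y n = 0"
proof -
  obtain a b c where n: "type_weights k y n = (a, b, c)" by (metis prod_cases3)
  show ?thesis
    unfolding total_weight_def q_coeff1_def q_coeff2_def q_coeff3_def type_weights.simps n
      Let_def prod.case
    by algebra
qed

text \<open>The left sides are the coefficients of \<open>x\<close>, \<open>x^2\<close>,
  \<open>x^3\<close> in the denominator times the series, which is where the numerator comes
  from.\<close>

lemma total_weight_init:
  "total_weight k y 0 = p_coeff1 k y"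
  "total_weight k y (Suc 0) + q_coeff1 k y * total_weight k y 0 = p_coeff2 k y"
  "total_weight k y (Suc (Suc 0)) + q_coeff1 k y * total_weight k y (Suc 0)
     + q_coeff2 k y * total_weight k y 0 = p_coeff3 k y"
  unfolding total_weight_def q_coeff1_def q_coeff2_def p_coeff1_def p_coeff2_def p_coeff3_def
    type_weights.simps prod.case Let_def
  by algebra+

section \<open>Columns of height three as triples of colors\<close>

definition triple :: "'c \<Rightarrow> 'c \<Rightarrow> 'c \<Rightarrow> nat \<Rightarrow> 'c" where
  "triple a b c = (\<lambda>i. if i = 0 then a else if i = 1 then b else if i = 2 then c else undefined)"

lemma less_3_iff: "i < 3 \<longleftrightarrow> i = 0 \<or> i = 1 \<or> i = (2::nat)"
  by auto

lemma sum_PiE_triple: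
  fixes S :: "'c set"
  shows "(\<Sum>g\<in>{..<3} \<rightarrow>\<^sub>E S. H g) = (\<Sum>a\<in>S. \<Sum>b\<in>S. \<Sum>c\<in>S. H (triple a b c))"
  unfolding sum.cartesian_product
proof (rule sum.reindex_bij_witness[where i = "\<lambda>(a, b, c). triple a b c"
      and j = "\<lambda>g. (g 0, g 1, g 2)"])
  fix g :: "nat \<Rightarrow> 'c" assume g: "g \<in> {..<3} \<rightarrow>\<^sub>E S"
  have "triple (g 0) (g 1) (g 2) = g"
    using PiE_arb[OF g] by (auto simp: triple_def fun_eq_iff less_3_iff)
  then show "(case (g 0, g 1, g 2) of (a, b, c) \<Rightarrow> triple a b c) = g"
    and "(case (g 0, g 1, g 2) of (a, b, c) \<Rightarrow> H (triple a b c)) = H g" by simp_all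
  show "(g 0, g 1, g 2) \<in> S \<times> S \<times> S"
    using PiE_mem[OF g] by (auto simp: less_3_iff)
qed (auto simp: triple_def less_3_iff intro!: PiE_I split: if_splits)

lemma image_triple: "triple a b c ` {..<3} = {a, b, c}"
proof -
  have "{..<3} = {0, 1, 2::nat}" by auto
  then show ?thesis by (auto simp: triple_def)
qed

lemma unmatched_triple:
  "unmatched 3 (triple p q r) (triple a b c) =
     {a, b, c} - ((if p = a then {a} else {}) \<union> (if q = b then {b} else {}) \<union> (if r = c then {c} else {}))"
proof -
  have "{F i | i. i < 3 \<and> P i} = (if P 0 then {F 0} else {}) \<union> (if P 1 then {F 1} else {})
      \<union> (if P 2 then {F 2} else {})" for F :: "nat \<Rightarrow> 'a" and P
    by (auto simp: less_3_iff intro: gr0I)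
  then have "{triple a b c i | i. i < 3 \<and> triple p q r i = triple a b c i} =
      (if p = a then {a} else {}) \<union> (if q = b then {b} else {}) \<union> (if r = c then {c} else {})"
    by (simp add: triple_def)
  then show ?thesis unfolding unmatched_def image_triple by simp
qed

text \<open>Each indicator in a monomial fixes one summation variable.\<close>

lemma sum_matched_triples:
  fixes F :: "nat \<Rightarrow> nat \<Rightarrow> nat \<Rightarrow> 'a::comm_ring_1"
  assumes "a < k" "b < k" "c < k"
  shows "(\<Sum>p<k. \<Sum>q<k. \<Sum>r<k. F p q r *
      (w0 + w1 * of_bool (p = a) + w2 * of_bool (q = b) + w3 * of_bool (r = c)
        + w12 * of_bool (p = a) * of_bool (q = b) + w13 * of_bool (p = a) * of_bool (r = c)
        + w23 * of_bool (q = b) * of_bool (r = c)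
        + w123 * of_bool (p = a) * of_bool (q = b) * of_bool (r = c))) =
    w0 * (\<Sum>p<k. \<Sum>q<k. \<Sum>r<k. F p q r)
      + w1 * (\<Sum>q<k. \<Sum>r<k. F a q r) + w2 * (\<Sum>p<k. \<Sum>r<k. F p b r) + w3 * (\<Sum>p<k. \<Sum>q<k. F p q c)
      + w12 * (\<Sum>r<k. F a b r) + w13 * (\<Sum>q<k. F a q c) + w23 * (\<Sum>p<k. F p b c)
      + w123 * F a b c"
proof -
  \<comment> \<open>Rules \<open>1\<close>, \<open>2\<close>, \<open>3\<close> collapse an indicator
    belonging to the outermost of one, two or three nested sums. After expansion they remove the
    indicators of a monomial from the last to the first.\<close>
  have 1: "(\<Sum>x<k. G x * of_bool (x = d)) = G d" if "d < k" for d and G :: "nat \<Rightarrow> 'a"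
  proof -
    have "(\<Sum>x<k. G x * of_bool (x = d)) = (\<Sum>x<k. if x = d then G x else 0)"
      by (intro sum.cong) auto
    with that show ?thesis by simp
  qed
  have 2: "(\<Sum>x<k. \<Sum>y<k. G x y * of_bool (x = d)) = (\<Sum>y<k. G d y)"
    if "d < k" for d and G :: "nat \<Rightarrow> nat \<Rightarrow> 'a"
    using 1[OF that, of "\<lambda>x. \<Sum>y<k. G x y"] by (simp add: sum_distrib_right)
  have 3: "(\<Sum>x<k. \<Sum>y<k. \<Sum>z<k. G x y z * of_bool (x = d)) = (\<Sum>y<k. \<Sum>z<k. G d y z)"
    if "d < k" for d and G :: "nat \<Rightarrow> nat \<Rightarrow> nat \<Rightarrow> 'a"
    using 1[OF that, of "\<lambda>x. \<Sum>y<k. \<Sum>z<k. G x y z"] by (simp add: sum_distrib_right)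
  show ?thesis
    by (simp only: distrib_left sum.distrib sum_distrib_left mult.assoc[symmetric] 1 2 3 assms)
      (simp only: mult.commute mult.left_commute)
qed

section \<open>Sums of weights that depend only on the number of colors\<close>

definition triple_weight :: "'a \<times> 'a \<times> 'a \<Rightarrow> 'c \<Rightarrow> 'c \<Rightarrow> 'c \<Rightarrow> 'a" where
  "triple_weight w a b c =
     (if a = b \<and> b = c then fst w else if a = b \<or> b = c \<or> a = c then fst (snd w) else snd (snd w))"


lemma sum_add_mult_of_bool:
  "d < k \<Longrightarrow> (\<Sum>x<k. u + v * of_bool (x = d)) = of_nat k * u + (v :: 'a::comm_ring_1)"
proof -
  assume "d < k"
  moreover have "(\<Sum>x<k. v * of_bool (x = d)) = (\<Sum>x<k. if x = d then v else 0)"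
    by (intro sum.cong) auto
  ultimately show ?thesis by (simp add: sum.distrib)
qed

text \<open>For an equal pair, one third entry keeps a single color and \<open>k - 1\<close> add a
  second; for a distinct pair, two repeat a color and \<open>k - 2\<close> add a third. These are
  \<open>s2\<close> and \<open>s2'\<close> of \<open>type_weights\<close>.\<close>

lemma sum_triple_weight_1:
  fixes w :: "'a::comm_ring_1 \<times> 'a \<times> 'a"
  assumes "a < k" "b < k"
  shows "(\<Sum>r<k. triple_weight w a b r) =
    (if a = b then fst w + (of_nat k - 1) * fst (snd w)
     else 2 * fst (snd w) + (of_nat k - 2) * snd (snd w))"
proof (cases "a = b")
  case True
  have "(\<Sum>r<k. triple_weight w a b r) =
      (\<Sum>r<k. fst (snd w) + (fst w - fst (snd w)) * of_bool (r = a))"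
    using True by (intro sum.cong) (auto simp: triple_weight_def)
  also have "\<dots> = of_nat k * fst (snd w) + (fst w - fst (snd w))"
    by (rule sum_add_mult_of_bool[OF assms(1)])
  finally show ?thesis using True by (simp add: algebra_simps)
next
  case False
  \<comment> \<open>Each repeated color corrects the three-color weight. The dummy
    \<open>0 +\<close> gives the second summand the shape of
    \<open>sum_add_mult_of_bool\<close>.\<close>
  have "(\<Sum>r<k. triple_weight w a b r) =
      (\<Sum>r<k. (snd (snd w) + (fst (snd w) - snd (snd w)) * of_bool (r = a))
        + (0 + (fst (snd w) - snd (snd w)) * of_bool (r = b)))"
    using False by (intro sum.cong) (auto simp: triple_weight_def)
  also have "\<dots> = of_nat k * snd (snd w) + 2 * (fst (snd w) - snd (snd w))"
    unfolding sum.distrib[where h = "\<lambda>r. 0 + (fst (snd w) - snd (snd w)) * of_bool (r = b)"]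
      sum_add_mult_of_bool[OF assms(1)] sum_add_mult_of_bool[OF assms(2)] by simp
  finally show ?thesis using False by (simp add: algebra_simps)
qed

lemma sum_triple_weight_1_other_positions:
  fixes w :: "'a::comm_ring_1 \<times> 'a \<times> 'a"
  shows "(\<Sum>q<k. triple_weight w a q b) = (\<Sum>r<k. triple_weight w a b r)"
    and "(\<Sum>p<k. triple_weight w p a b) = (\<Sum>r<k. triple_weight w a b r)"
  by (rule sum.cong; auto simp: triple_weight_def)+

lemma sum_triple_weight_2:
  fixes w :: "'a::comm_ring_1 \<times> 'a \<times> 'a"
  assumes "a < k"
  shows "(\<Sum>q<k. \<Sum>r<k. triple_weight w a q r) =
    fst w + 3 * (of_nat k - 1) * fst (snd w) + (of_nat k - 1) * (of_nat k - 2) * snd (snd w)"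
proof -
  let ?u = "2 * fst (snd w) + (of_nat k - 2) * snd (snd w)"
  have "(\<Sum>q<k. \<Sum>r<k. triple_weight w a q r) =
      (\<Sum>q<k. ?u + (fst w + (of_nat k - 1) * fst (snd w) - ?u) * of_bool (q = a))"
    using assms by (intro sum.cong) (auto simp: sum_triple_weight_1)
  also have "\<dots> = of_nat k * ?u + (fst w + (of_nat k - 1) * fst (snd w) - ?u)"
    by (rule sum_add_mult_of_bool[OF assms])
  finally show ?thesis by (simp add: algebra_simps)
qed

lemma sum_triple_weight_2_other_positions:
  fixes w :: "'a::comm_ring_1 \<times> 'a \<times> 'a"
  shows "(\<Sum>p<k. \<Sum>r<k. triple_weight w p a r) = (\<Sum>q<k. \<Sum>r<k. triple_weight w a q r)"
    and "(\<Sum>p<k. \<Sum>q<k. triple_weight w p q a) = (\<Sum>q<k. \<Sum>r<k. triple_weight w a q r)"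
  by (intro sum.cong refl; auto simp: triple_weight_def)+

lemma sum_triple_weight_3:
  fixes w :: "'a::comm_ring_1 \<times> 'a \<times> 'a"
  shows "(\<Sum>p<k. \<Sum>q<k. \<Sum>r<k. triple_weight w p q r) =
    of_nat k * fst w + 3 * of_nat k * (of_nat k - 1) * fst (snd w)
      + of_nat k * (of_nat k - 1) * (of_nat k - 2) * snd (snd w)"
  by (simp add: sum_triple_weight_2 algebra_simps)

text \<open>A color contributes \<open>1\<close> if one of its positions is matched and
  \<open>y\<close> otherwise, that is, \<open>y + z\<close> times one minus the product of
  \<open>1 - e\<close> over the indicators \<open>e\<close> at its positions. Multiplying over the
  \<open>t\<close> colors gives the coefficients. The truncated \<open>t - 2\<close> occurs only for
  distinct \<open>u\<close>, \<open>v\<close>, where \<open>t\<close> \<ge> 2.\<close>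

lemma power_card_unmatched_triple:
  fixes y :: "'a::comm_ring_1"
  defines "z \<equiv> 1 - y"
  defines "pair \<equiv> \<lambda>t u v. if u = v then - (y ^ (t - 1) * z) else y ^ (t - 2) * z ^ 2"
  shows "y ^ card (unmatched 3 (triple p q r) (triple a b c)) =
    (let t = card {a, b, c} in
       y ^ t + y ^ (t - 1) * z * of_bool (p = a) + y ^ (t - 1) * z * of_bool (q = b)
         + y ^ (t - 1) * z * of_bool (r = c)
         + pair t a b * of_bool (p = a) * of_bool (q = b)
         + pair t a c * of_bool (p = a) * of_bool (r = c)
         + pair t b c * of_bool (q = b) * of_bool (r = c)
         + (- 1) ^ (3 - t) * z ^ t * of_bool (p = a) * of_bool (q = b) * of_bool (r = c))"
  unfolding unmatched_triple pair_def z_def Let_def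
  by (cases "a = b"; cases "b = c"; cases "a = c"; cases "p = a"; cases "q = b"; cases "r = c")
    (simp_all add: insert_Diff_if card_insert_if power2_eq_square power3_eq_cube algebra_simps)

text \<open>The expansion in indicators leaves only sums with prescribed entries, and these depend
  only on which prescribed entries coincide; so dependence on the number of colors alone passes from
  column to column.\<close>

lemma column_weight_triple:
  fixes y :: "'a::idom"
  assumes "a < k" "b < k" "c < k"
  shows "column_weight y k 3 n (triple a b c) = triple_weight (type_weights (of_nat k) y n) a b c"
  using assms
proof (induction n arbitrary: a b c)
  case 0
  show ?case
    unfolding column_weight_0 image_triple
    by (auto simp: triple_weight_def card_insert_if power2_eq_square power3_eq_cube)
next
  case (Suc n)
  obtain u v w where uvw: "type_weights (of_nat k) y n = (u, v, w)" by (metis prod_cases3)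
  have "column_weight y k 3 (Suc n) (triple a b c) =
     (\<Sum>p<k. \<Sum>q<k. \<Sum>r<k. triple_weight (u, v, w) p q r
        * y ^ card (unmatched 3 (triple p q r) (triple a b c)))"
    unfolding column_weight_Suc sum_PiE_triple
    by (intro sum.cong refl) (simp add: Suc.IH uvw)
  also have "\<dots> = triple_weight (type_weights (of_nat k) y (Suc n)) a b c"
  proof -
    note sums = power_card_unmatched_triple[of y] Let_def sum_matched_triples[OF Suc.prems]
      sum_triple_weight_2_other_positions[where a = b]
      sum_triple_weight_2_other_positions[where a = c]
      sum_triple_weight_1_other_positions[where a = a and b = c]
      sum_triple_weight_1_other_positions[where a = b and b = c]
      sum_triple_weight_3 sum_triple_weight_2[OF Suc.prems(1)] sum_triple_weight_2[OF Suc.prems(2)]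
      sum_triple_weight_2[OF Suc.prems(3)] sum_triple_weight_1[OF Suc.prems(1,2)]
      sum_triple_weight_1[OF Suc.prems(1,3)] sum_triple_weight_1[OF Suc.prems(2,3)]
    \<comment> \<open>The five ways in which three entries can coincide; each leaves a polynomial
      identity.\<close>
    consider "a = b" "b = c" | "a = b" "b \<noteq> c" | "a = c" "a \<noteq> b" | "b = c" "a \<noteq> b"
      | "a \<noteq> b" "b \<noteq> c" "a \<noteq> c" by blast
    then show ?thesis
      unfolding sums
      by cases (simp_all add: triple_weight_def uvw Let_def card_insert_if algebra_simps
          power2_eq_square power3_eq_cube)
  qed
  finally show ?case .
qed

section \<open>The generating function\<close>

text \<open>\<open>fps_const\<close> is a ring homomorphism and so commutes with these
  polynomials.\<close>

lemma fps_const_coeffs: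
  "fps_const (q_coeff1 (of_nat k) y) = q_coeff1 (of_nat k) (fps_const (y :: 'a::idom))"
  "fps_const (q_coeff2 (of_nat k) y) = q_coeff2 (of_nat k) (fps_const y)"
  "fps_const (q_coeff3 (of_nat k) y) = q_coeff3 (of_nat k) (fps_const y)"
  "fps_const (p_coeff1 (of_nat k) y) = p_coeff1 (of_nat k) (fps_const y)"
  "fps_const (p_coeff2 (of_nat k) y) = p_coeff2 (of_nat k) (fps_const y)"
  "fps_const (p_coeff3 (of_nat k) y) = p_coeff3 (of_nat k) (fps_const y)"
  unfolding q_coeff1_def q_coeff2_def q_coeff3_def p_coeff1_def p_coeff2_def p_coeff3_def
    fps_const_add[symmetric] fps_const_mult[symmetric] fps_const_sub[symmetric]
    fps_const_neg[symmetric] fps_const_power[symmetric] numeral_fps_const[symmetric]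
    fps_const_1_eq_1 fps_of_nat
  by (rule refl)+

lemma q_xy_eq: "q_xy k x y = 1 + q_coeff1 k y * x + q_coeff2 k y * x^2 + q_coeff3 k y * x^3"
  unfolding q_xy_def q_coeff1_def q_coeff2_def q_coeff3_def by algebra

lemma p_xy_eq: "p_xy k x y = p_coeff1 k y * x + p_coeff2 k y * x^2 + p_coeff3 k y * x^3"
  unfolding p_xy_def p_coeff1_def p_coeff2_def p_coeff3_def by algebra

lemma q_xy_mult_total_weight:
  fixes y :: "'a::idom"
  shows "q_xy (of_nat k) fps_X (fps_const y)
      * Abs_fps (\<lambda>n. if n = 0 then 0 else total_weight (of_nat k) y (n - 1)) =
    p_xy (of_nat k) fps_X (fps_const y)"
proof -
  let ?K = "of_nat k :: 'a"
  define T where "T = Abs_fps (\<lambda>n. if n = 0 then 0 else total_weight ?K y (n - 1))"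
  have T: "fps_nth T 0 = 0" "fps_nth T (Suc n) = total_weight ?K y n" for n
    by (simp_all add: T_def)
  have "T + fps_const (q_coeff1 ?K y) * (fps_X * T) + fps_const (q_coeff2 ?K y) * (fps_X^2 * T)
      + fps_const (q_coeff3 ?K y) * (fps_X^3 * T) =
    fps_const (p_coeff1 ?K y) * fps_X + fps_const (p_coeff2 ?K y) * fps_X^2
      + fps_const (p_coeff3 ?K y) * fps_X^3" (is "?L = ?R")
  proof (rule fps_ext)
    fix n
    \<comment> \<open>From \<open>x^4\<close> on all four terms on the left contribute and cancel by
      the recursion; below that the initial values apply.\<close>
    consider "n = 0" | "n = Suc 0" | "n = Suc (Suc 0)" | "n = Suc (Suc (Suc 0))"
      | l where "n = Suc (Suc (Suc (Suc l)))"
      by (metis not0_implies_Suc)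
    then show "fps_nth ?L n = fps_nth ?R n"
    proof cases
      case 5
      then show ?thesis using total_weight_rec[of ?K y l]
        by (simp add: T fps_X_power_mult_nth fps_X_power_nth fps_X_nth)
    qed (use total_weight_init[of ?K y] in
        \<open>simp_all add: T fps_X_power_mult_nth fps_X_power_nth fps_X_nth\<close>)
  qed
  then show ?thesis
    unfolding T_def[symmetric] q_xy_eq p_xy_eq fps_const_coeffs by (simp add: algebra_simps)
qed

lemma T_gf_nth_Suc: "fps_nth (T_gf k) (Suc n) = total_weight (of_nat k) [:0, 1:] n"
proof -
  let ?y = "[:0, 1:] :: int poly"
  have "fps_nth (T_gf k) (Suc n) =
      (\<Sum>T\<in>colored_partitions k (prism 3 (Suc n)). ?y ^ card (fst T))"
    by (simp add: T_gf_def partition_size_def U_def prism_def monom_altdef)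
  also have "\<dots> = (\<Sum>f\<in>fst (prism 3 (Suc n)) \<rightarrow>\<^sub>E {..<k}.
      ?y ^ card (mono_components (prism 3 (Suc n)) f))"
    by (rule sum_colored_partitions)
  also have "\<dots> = (\<Sum>a<k. \<Sum>b<k. \<Sum>c<k. triple_weight (type_weights (of_nat k) ?y n) a b c)"
    unfolding sum_power_mono_components_prism_Suc sum_PiE_triple
    by (intro sum.cong refl) (simp add: column_weight_triple)
  also have "\<dots> = total_weight (of_nat k) ?y n"
    unfolding sum_triple_weight_3 total_weight_def by (simp add: case_prod_beta)
  finally show ?thesis .
qed

lemma q_xy_mult_T_gf:
  "q_xy (of_nat k) fps_X (fps_const [:0, 1:]) * T_gf k = p_xy (of_nat k) fps_X (fps_const [:0, 1:])"
proof -
  have "T_gf k = Abs_fps (\<lambda>n. if n = 0 then 0 else total_weight (of_nat k) [:0, 1:] (n - 1))"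
  proof (rule fps_ext)
    fix n
    show "fps_nth (T_gf k) n =
        fps_nth (Abs_fps (\<lambda>n. if n = 0 then 0 else total_weight (of_nat k) [:0, 1:] (n - 1))) n"
      by (cases n) (simp_all add: T_gf_nth_Suc, simp add: T_gf_def)
  qed
  then show ?thesis by (simp only: q_xy_mult_total_weight)
qed

text \<open>At \<open>y = 1\<close> every colored partition counts once, and these correspond to the
  arbitrary colorings of \<open>3 * n\<close> vertices.\<close>

lemma poly_T_gf_nth_1:
  assumes "n \<ge> 1"
  shows "poly (fps_nth (T_gf k) n) 1 = int k ^ (3 * n)"
proof -
  have "poly (fps_nth (T_gf k) n) 1 = (\<Sum>T\<in>colored_partitions k (prism 3 n). 1)"
    using assms by (simp add: T_gf_def U_def prism_def poly_sum poly_monom)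
  also have "\<dots> = (\<Sum>f\<in>fst (prism 3 n) \<rightarrow>\<^sub>E {..<k}. 1)"
    by (rule sum_colored_partitions)
  also have "\<dots> = int k ^ (3 * n)"
    by (simp add: fst_prism card_PiE card_cartesian_product)
  finally show ?thesis .
qed

lemma to_fract_sum: "to_fract (sum f A) = (\<Sum>x\<in>A. to_fract (f x))"
  by (induction A rule: infinite_finite_induct) (simp_all add: to_fract_add)

text \<open>Carries the division-free identity over to the fraction field.\<close>

lemma fract_fps_mult: "fract_fps (F * G) = fract_fps F * fract_fps G"
  by (rule fps_ext) (simp add: fract_fps_def fps_mult_nth to_fract_sum to_fract_mult)

theorem theorem6p1:
  fixes k :: nat
  assumes "k \<ge> 1"
  shows "fract_fps (T_gf k) =
      fract_fps (p_xy (of_nat k) fps_X (fps_const [:0, 1:]))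
        / fract_fps (q_xy (of_nat k) fps_X (fps_const [:0, 1:]))
    \<and> (\<forall>n\<ge>1. poly (fps_nth (T_gf k) n) 1 = int k ^ (3 * n))"
proof
  let ?p = "p_xy (of_nat k) fps_X (fps_const [:0, 1:]) :: int poly fps"
  let ?q = "q_xy (of_nat k) fps_X (fps_const [:0, 1:]) :: int poly fps"
  \<comment> \<open>The constant coefficient shows that the denominator is nonzero and can be
    cancelled.\<close>
  have "fps_nth (fract_fps ?q) 0 = 1"
    by (simp add: fract_fps_def q_xy_eq)
  then have "fract_fps ?q \<noteq> 0" by auto
  moreover have "fract_fps ?q * fract_fps (T_gf k) = fract_fps ?p"
    by (simp only: fract_fps_mult[symmetric] q_xy_mult_T_gf)
  ultimately show "fract_fps (T_gf k) = fract_fps ?p / fract_fps ?q"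
    by (metis nonzero_mult_div_cancel_left)
  show "\<forall>n\<ge>1. poly (fps_nth (T_gf k) n) 1 = int k ^ (3 * n)"
    by (simp add: poly_T_gf_nth_1)
qed

end
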